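(* Let $\mathcal{C}=(I,A,(\rho_i)_{i\in I},(C^a)_{a\in A})$ be a Cartan scheme of rank two. If $\mathcal{R}^{\mathrm{re}}(\mathcal{C})=(\mathcal{C},(R^a)_{a\in A})$ is a finite root system of type $\mathcal{C}$ then, for all $a\in A$ and $\alpha\in R^a_+$, either $\alpha$ is simple (that is, $\alpha=\alpha_i$ for some $i\in I$) or $\alpha$ is the sum of two positive roots in $R^a_+$.
   Context: Cartan schemes (rank two). Let $I$ be a set with $|I|=2$, $A$ a non-empty set, $\rho_i:A\to A$ a map for each $i\in I$, and $C^a=(c^a_{jk})_{j,k\in I}$ an integer matrix for each $a\in A$. The quadruple $\mathcal{C}=(I,A,(\rho_i)_{i\in I},(C^a)_{a\in A})$ is a Cartan scheme of rank two if every $C^a$ is a generalized Cartan matrix ($c^a_{ii}=2$; $c^a_{ij}\le 0$ for $i\ne j$; $c^a_{ij}=0$ implies $c^a_{ji}=0$), $\rho_i^2=\mathrm{id}$ for all $i$, and $c^a_{ij}=c^{\rho_i(a)}_{ij}$ for all $a\in A$, $i,j\in I$. Let $(\alpha_i)_{i\in I}$ be the standard basis of $\mathbb{Z}^I$ and let $\sigma_i^a\in\mathrm{Aut}(\mathbb{Z}^I)$, $\sigma_i^a(\alpha_j)=\alpha_j-c^a_{ij}\alpha_i$. The Weyl groupoid $\mathcal{W}(\mathcal{C})$ is the category with object set $A$ whose morphisms are generated by the maps $\sigma_i^a$, regarded as elements of $\mathrm{Hom}(a,\rho_i(a))$ (so $\mathrm{Hom}(a,b)$ is the set of linear maps obtained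 as compositions of such maps along a path from $a$ to $b$). The real roots at $a$ are $R^a=\{\varphi(\alpha_i)\mid i\in I,\ \varphi\in\mathrm{Hom}(b,a),\ b\in A\}$, $R^a_+=R^a\cap\mathbb{N}_0^I$, and $\mathcal{R}^{\mathrm{re}}(\mathcal{C})=(\mathcal{C},(R^a)_{a\in A})$. A family $(R^a)_{a\in A}$ of subsets of $\mathbb{Z}^I$ is a root system of type $\mathcal{C}$ if, with $R^a_+=R^a\cap\mathbb{N}_0^I$: (R1) $R^a=R^a_+\cup -R^a_+$; (R2) $R^a\cap\mathbb{Z}\alpha_i=\{\alpha_i,-\alpha_i\}$; (R3) $\sigma_i^a(R^a)=R^{\rho_i(a)}$; (R4) if $i\ne j$ and $m=|R^a\cap(\mathbb{N}_0\alpha_i+\mathbb{N}_0\alpha_j)|$ is finite then $(\rho_i\rho_j)^m(a)=a$. It is finite if all $R^a$ are finite. *)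

theory Defs
  imports "HOL-Analysis.Analysis"
begin

text \<open>
  The index set $I$ is the finite type \<open>'i\<close>, so that $\mathbb{Z}^I$ is \<open>int ^ 'i\<close>.
  The entry $c^a_{jk}$ is \<open>cartan S a $ j $ k\<close>.
\<close>

record ('i::finite, 'a) cartan_quadruple =
  objects :: "'a set"
  rho :: "'i \<Rightarrow> 'a \<Rightarrow> 'a"
  cartan :: "'a \<Rightarrow> int ^ 'i ^ 'i"

definition generalized_cartan_matrix :: "int ^ 'i ^ 'i \<Rightarrow> bool" where
  "generalized_cartan_matrix C \<longleftrightarrow>
     (\<forall>i. C $ i $ i = 2) \<and>
     (\<forall>i j. i \<noteq> j \<longrightarrow> C $ i $ j \<le> 0) \<and>
     (\<forall>i j. C $ i $ j = 0 \<longrightarrow> C $ j $ i = 0)"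

definition cartan_scheme :: "('i::finite, 'a) cartan_quadruple \<Rightarrow> bool" where
  "cartan_scheme S \<longleftrightarrow>
     objects S \<noteq> {} \<and>
     (\<forall>i. rho S i \<in> objects S \<rightarrow> objects S) \<and>
     (\<forall>a\<in>objects S. generalized_cartan_matrix (cartan S a)) \<and>
     (\<forall>i. \<forall>a\<in>objects S. rho S i (rho S i a) = a) \<and>
     (\<forall>a\<in>objects S. \<forall>i j. cartan S a $ i $ j = cartan S (rho S i a) $ i $ j)"

definition cartan_scheme_rank_two :: "('i::finite, 'a) cartan_quadruple \<Rightarrow> bool" where
  "cartan_scheme_rank_two S \<longleftrightarrow> cartan_scheme S \<and> CARD('i) = 2"

definition simple_root :: "'i \<Rightarrow> int ^ 'i" where
  "simple_root i = axis i 1"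

text \<open>
  The map $\sigma_i^a$ is the linear extension of its values on the basis;
  see \<open>simple_reflection_simple_root\<close> and \<open>bij_simple_reflection\<close> below.
\<close>

definition simple_reflection ::
    "('i::finite, 'a) cartan_quadruple \<Rightarrow> 'i \<Rightarrow> 'a \<Rightarrow> int ^ 'i \<Rightarrow> int ^ 'i" where
  "simple_reflection S i a v =
     (\<Sum>j\<in>UNIV. v $ j *s (simple_root j - cartan S a $ i $ j *s simple_root i))"

inductive weyl_morphism ::
    "('i::finite, 'a) cartan_quadruple \<Rightarrow> 'a \<Rightarrow> 'a \<Rightarrow> (int ^ 'i \<Rightarrow> int ^ 'i) \<Rightarrow> bool"
  for S :: "('i, 'a) cartan_quadruple" and a :: 'a where
  identity: "a \<in> objects S \<Longrightarrow> weyl_morphism S a a id"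
| compose_refl:
    "weyl_morphism S a b \<phi> \<Longrightarrow>
       weyl_morphism S a (rho S i b) (simple_reflection S i b \<circ> \<phi>)"

definition weyl_hom ::
    "('i::finite, 'a) cartan_quadruple \<Rightarrow> 'a \<Rightarrow> 'a \<Rightarrow> (int ^ 'i \<Rightarrow> int ^ 'i) set" where
  "weyl_hom S a b = {\<phi>. weyl_morphism S a b \<phi>}"

definition real_roots :: "('i::finite, 'a) cartan_quadruple \<Rightarrow> 'a \<Rightarrow> (int ^ 'i) set" where
  "real_roots S a =
     {\<phi> (simple_root i) | i \<phi> b. b \<in> objects S \<and> \<phi> \<in> weyl_hom S b a}"

definition positive_part :: "(int ^ 'i) set \<Rightarrow> (int ^ 'i) set" where
  "positive_part R = R \<inter> {v. \<forall>i. 0 \<le> v $ i}"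

definition root_system ::
    "('i::finite, 'a) cartan_quadruple \<Rightarrow> ('a \<Rightarrow> (int ^ 'i) set) \<Rightarrow> bool" where
  "root_system S R \<longleftrightarrow>
     (\<forall>a\<in>objects S. R a = positive_part (R a) \<union> uminus ` positive_part (R a)) \<and>
     (\<forall>a\<in>objects S. \<forall>i.
        R a \<inter> {k *s simple_root i | k. True} = {simple_root i, - simple_root i}) \<and>
     (\<forall>a\<in>objects S. \<forall>i. simple_reflection S i a ` R a = R (rho S i a)) \<and>
     (\<forall>a\<in>objects S. \<forall>i j. i \<noteq> j \<longrightarrow>
        (let M = R a \<inter> {int p *s simple_root i + int q *s simple_root j | p q. True}
         in finite M \<longrightarrow> ((rho S i \<circ> rho S j) ^^ card M) a = a))"

definition finite_root_system ::
    "('i::finite, 'a) cartan_quadruple \<Rightarrow> ('a \<Rightarrow> (int ^ 'i) set) \<Rightarrow> bool" where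
  "finite_root_system S R \<longleftrightarrow> root_system S R \<and> (\<forall>a\<in>objects S. finite (R a))"

lemma simple_reflection_eq:
  "simple_reflection S i a v = v - (\<Sum>j\<in>UNIV. cartan S a $ i $ j * v $ j) *s simple_root i"
proof -
  have "(\<Sum>j\<in>UNIV. v $ j * simple_root j $ k) = v $ k" for k
    by (simp add: simple_root_def axis_def if_distrib cong: if_cong)
  then show ?thesis
    by (simp add: simple_reflection_def vec_eq_iff right_diff_distrib sum_subtractf sum_distrib_right
        mult.assoc mult.left_commute)
qed

lemma simple_reflection_simple_root:
  "simple_reflection S i a (simple_root j) = simple_root j - cartan S a $ i $ j *s simple_root i"
  by (simp add: simple_reflection_eq simple_root_def axis_def if_distrib cong: if_cong)

lemma simple_reflection_add:
  "simple_reflection S i a (v + w) = simple_reflection S i a v + simple_reflection S i a w"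
  by (simp add: simple_reflection_eq vec_eq_iff algebra_simps sum.distrib)

lemma simple_reflection_invol:
  assumes "cartan_scheme S" "a \<in> objects S"
  shows "simple_reflection S i a (simple_reflection S i a v) = v"
proof -
  have c: "cartan S a $ i $ i = 2"
    using assms by (auto simp: cartan_scheme_def generalized_cartan_matrix_def)
  let ?p = "\<lambda>v. \<Sum>j\<in>UNIV. cartan S a $ i $ j * v $ j"
  have "?p (simple_root i) = 2"
    by (simp add: simple_root_def axis_def if_distrib c cong: if_cong)
  moreover have "?p (v - t *s simple_root i) = ?p v - t * ?p (simple_root i)" for t
    by (simp add: right_diff_distrib sum_subtractf sum_distrib_left mult.left_commute)
  ultimately have "?p (v - ?p v *s simple_root i) = - ?p v"
    by presburger
  then show ?thesis
    unfolding simple_reflection_eq by (simp add: vec_eq_iff)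
qed

lemma bij_simple_reflection: "cartan_scheme S \<Longrightarrow> a \<in> objects S \<Longrightarrow> bij (simple_reflection S i a)"
  by (rule o_bij[where g = "simple_reflection S i a"]) (auto simp: simple_reflection_invol)

end

theory Submission
  imports Defs
begin

text \<open>
  Any root \<open>\<alpha>\<close> at \<open>a\<close> is the image of a simple root at some \<open>b\<close>, and the images of the two simple
  roots at \<open>b\<close> form a basis such that all roots at \<open>a\<close> have coordinates of equal sign in it. Hence
  each positive root other than the last simple one has a positive root after it, in the order of
  slopes, which together with it spans the lattice with determinant 1; by symmetry the same holds
  on the other side. In a finite set of nonnegative vectors with such neighbours, a non-simple
  vector of maximal height is the sum of its two neighbours, which then become neighbours of each
  other when it is deleted; so one concludes by induction on the size of the set.
\<close>

text \<open>The determinant of the pair \<open>x\<close>, \<open>y\<close>. For nonnegative vectors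
  its sign compares slopes, positive meaning that \<open>y\<close> lies closer to
  \<open>simple_root j\<close>; the value 1 expresses "\<open>y\<close> is a neighbour after
  \<open>x\<close>".\<close>

definition wedge :: "'i \<Rightarrow> 'i \<Rightarrow> int ^ 'i \<Rightarrow> int ^ 'i \<Rightarrow> int" where
  "wedge i j x y = x $ i * y $ j - x $ j * y $ i"

lemma vec_eq_two_iff:
  fixes x y :: "int ^ 'i"
  assumes "UNIV = {i, j :: 'i}"
  shows "x = y \<longleftrightarrow> x $ i = y $ i \<and> x $ j = y $ j"
proof -
  have "(\<forall>k. P k) \<longleftrightarrow> P i \<and> P j" for P :: "'i \<Rightarrow> bool"
    using assms by (metis UNIV_I insertE singletonD)
  then show ?thesis by (simp add: vec_eq_iff)
qed

lemma simple_root_nth: "simple_root k $ l = (if l = k then 1 else 0)"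
  by (simp add: simple_root_def axis_def)

section \<open>Unimodular sets of vectors in the quadrant\<close>

text \<open>The linear relation between three plane vectors reads \<open>u + v = c w\<close> with
  \<open>c\<close> the determinant of \<open>u\<close>, \<open>v\<close>; comparing heights
  (coordinate sums) leaves only \<open>c = 1\<close>.\<close>

lemma unimodular_neighbours_sum:
  fixes u v w :: "int ^ 'i"
  assumes U: "UNIV = {i, j :: 'i}"
    and uw: "wedge i j u w = 1" and wv: "wedge i j w v = 1"
    and nn: "0 \<le> u $ i" "0 \<le> u $ j" "0 \<le> v $ i" "0 \<le> v $ j"
    and le: "u $ i + u $ j \<le> w $ i + w $ j" "v $ i + v $ j \<le> w $ i + w $ j"
    and h: "1 < w $ i + w $ j"
  shows "w = u + v"
proof -
  let ?h = "\<lambda>x :: int ^ 'i. x $ i + x $ j"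
  define c where "c = wedge i j u v"
  \<comment> \<open>Cramer's rule with denominators cleared.\<close>
  have "c * w $ k = wedge i j w v * u $ k + wedge i j u w * v $ k" if "k \<in> {i, j}" for k
    using that by (auto simp: c_def wedge_def algebra_simps)
  then have plucker: "c * w $ k = u $ k + v $ k" if "k \<in> {i, j}" for k
    using that uw wv by simp
  have hc: "c * ?h w = ?h u + ?h v"
    using plucker[of i] plucker[of j] by (simp add: distrib_left)
  have "?h u < ?h w"
  proof (rule ccontr)
    assume "\<not> ?h u < ?h w"
    then have eq: "?h u = ?h w" using le(1) by linarith
    \<comment> \<open>Replacing the second coordinate by the height keeps the determinant. With
      equal heights, the height of \<open>w\<close> would then divide 1.\<close>
    have "u $ i * ?h w - w $ i * ?h u = 1"
      using uw by (simp add: wedge_def algebra_simps)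
    then have "(u $ i - w $ i) * ?h w = 1"
      by (simp add: eq left_diff_distrib)
    then have "?h w dvd 1" by (metis dvd_triv_right)
    then show False using h by auto
  qed
  then have upper: "c * ?h w < 2 * ?h w" unfolding hc using le by simp
  have "u $ i \<noteq> 0 \<or> u $ j \<noteq> 0" using uw by (auto simp: wedge_def)
  then have lower: "0 * ?h w < c * ?h w" unfolding hc using nn by auto
  have "c < 2" "0 < c"
    using upper lower h unfolding mult_less_cancel_right by auto
  then have "c = 1" by linarith
  then show ?thesis using plucker by (simp add: vec_eq_two_iff[OF U])
qed

text \<open>Roots are not mentioned, so that the hypotheses can survive the deletion of a vector of
  maximal height: a neighbour relation through the deleted vector is replaced by one between its own
  two neighbours.\<close>

lemma unimodular_set_decomposition:
  fixes F :: "(int ^ 'i) set"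
  assumes U: "UNIV = {i, j :: 'i}" and ij: "i \<noteq> j"
    and "finite F"
    and "\<And>x. x \<in> F \<Longrightarrow> 0 \<le> x $ i \<and> 0 \<le> x $ j"
    and "\<And>x. x \<in> F \<Longrightarrow> x \<noteq> simple_root j \<Longrightarrow> \<exists>y\<in>F. wedge i j x y = 1"
    and "\<And>x. x \<in> F \<Longrightarrow> x \<noteq> simple_root i \<Longrightarrow> \<exists>y\<in>F. wedge i j y x = 1"
    and "x \<in> F"
  shows "x = simple_root i \<or> x = simple_root j \<or> (\<exists>y\<in>F. \<exists>z\<in>F. x = y + z)"
  using assms(3-)
proof (induction F arbitrary: x rule: finite_psubset_induct)
  case (psubset F)
  note nn = psubset.prems(1) and succ = psubset.prems(2) and pred = psubset.prems(3)
  let ?h = "\<lambda>x :: int ^ 'i. x $ i + x $ j"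
  show ?case
  proof (cases "\<exists>x\<in>F. 1 < ?h x")
    case False
    \<comment> \<open>The zero vector has determinant 0 with everything, hence no neighbour. A
      nonzero nonnegative vector of height at most 1 is a unit vector.\<close>
    have "x $ i \<noteq> 0 \<or> x $ j \<noteq> 0"
    proof (cases "x = simple_root j")
      case True
      then show ?thesis by (simp add: simple_root_nth)
    next
      case False
      then show ?thesis using succ[OF psubset.prems(4)] by (auto simp: wedge_def)
    qed
    moreover have "?h x \<le> 1" using False psubset.prems(4) by force
    moreover have "0 \<le> x $ i \<and> 0 \<le> x $ j" using nn psubset.prems(4) .
    ultimately have "(x $ i = 1 \<and> x $ j = 0) \<or> (x $ i = 0 \<and> x $ j = 1)" by linarith
    then show ?thesis using ij by (auto simp: vec_eq_two_iff[OF U] simple_root_nth)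
  next
    case True
    have "Max (?h ` F) \<in> ?h ` F"
      using psubset.hyps(1) psubset.prems(4) by (intro Max_in) auto
    then obtain w where w: "w \<in> F" "?h w = Max (?h ` F)" by auto
    have max: "?h x \<le> ?h w" if "x \<in> F" for x
      using psubset.hyps(1) that unfolding w(2) by (intro Max_ge) auto
    have h: "1 < ?h w" using True max by fastforce
    have "w \<noteq> simple_root i" "w \<noteq> simple_root j"
      using h ij by (auto simp: simple_root_nth)
    then obtain u v where u: "u \<in> F" "wedge i j u w = 1" and v: "v \<in> F" "wedge i j w v = 1"
      using pred succ w(1) by blast
    \<comment> \<open>Stated for arbitrary neighbours, since it also makes the neighbours of
      \<open>w\<close> unique on each side: fixing one determines the other.\<close>
    have sum: "w = y + z" if "y \<in> F" "wedge i j y w = 1" "z \<in> F" "wedge i j w z = 1" for y z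
      using unimodular_neighbours_sum[OF U that(2,4)] nn[OF that(1)] nn[OF that(3)]
        max[OF that(1)] max[OF that(3)] h by blast
    have uv: "w = u + v" using sum u v by blast
    have wedge_uv: "wedge i j u v = 1"
      using u(2) by (simp add: uv wedge_def algebra_simps)
    have neq: "u \<noteq> w" "v \<noteq> w" using u(2) v(2) by (auto simp: wedge_def algebra_simps)
    show ?thesis
    proof (cases "x = w")
      case True
      then show ?thesis using uv u v by blast
    next
      case False
      have "x = simple_root i \<or> x = simple_root j \<or> (\<exists>y\<in>F - {w}. \<exists>z\<in>F - {w}. x = y + z)"
      proof (rule psubset.IH)
        show "F - {w} \<subset> F" using w(1) by blast
        show "x \<in> F - {w}" using False psubset.prems(4) by blast
        show "0 \<le> y $ i \<and> 0 \<le> y $ j" if "y \<in> F - {w}" for y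
          using nn that by blast
        show "\<exists>z\<in>F - {w}. wedge i j y z = 1" if y: "y \<in> F - {w}" "y \<noteq> simple_root j" for y
        proof -
          obtain z where z: "z \<in> F" "wedge i j y z = 1" using succ y by blast
          show ?thesis
          proof (cases "z = w")
            case True
            \<comment> \<open>If \<open>w\<close> was the successor of \<open>y\<close>, then
              \<open>y\<close> is the unique predecessor \<open>u\<close>, and \<open>v\<close>
              takes over as its successor.\<close>
            then have "w = y + v" using sum y z v by blast
            then have "y = u" using uv by simp
            then show ?thesis using wedge_uv v neq by blast
          qed (use z in blast)
        qed
        show "\<exists>z\<in>F - {w}. wedge i j z y = 1" if y: "y \<in> F - {w}" "y \<noteq> simple_root i" for y
        proof -
          obtain z where z: "z \<in> F" "wedge i j z y = 1" using pred y by blast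
          show ?thesis
          proof (cases "z = w")
            case True
            then have "w = u + y" using sum y z u by blast
            then have "y = v" using uv by simp
            then show ?thesis using wedge_uv u neq by blast
          qed (use z in blast)
        qed
      qed
      then show ?thesis by blast
    qed
  qed
qed

section \<open>Neighbours of real roots\<close>

lemma simple_reflection_scale:
  "simple_reflection S i a (t *s v) = t *s simple_reflection S i a v"
  by (simp add: simple_reflection_eq vec_eq_iff algebra_simps sum_distrib_left)

lemma weyl_morphism_compose:
  assumes "weyl_morphism S b c \<psi>" "weyl_morphism S a b \<phi>"
  shows "weyl_morphism S a c (\<psi> \<circ> \<phi>)"
  using assms
proof (induction rule: weyl_morphism.induct)
  case identity
  then show ?case by simp
next
  case (compose_refl c \<psi> i)
  then show ?case using weyl_morphism.compose_refl by (metis comp_assoc)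
qed

lemma weyl_morphism_add: "weyl_morphism S a b \<phi> \<Longrightarrow> \<phi> (v + w) = \<phi> v + \<phi> w"
  by (induction rule: weyl_morphism.induct) (auto simp: simple_reflection_add)

lemma weyl_morphism_scale: "weyl_morphism S a b \<phi> \<Longrightarrow> \<phi> (t *s v) = t *s \<phi> v"
  by (induction rule: weyl_morphism.induct) (auto simp: simple_reflection_scale)

lemma rho_in_objects: "cartan_scheme S \<Longrightarrow> a \<in> objects S \<Longrightarrow> rho S i a \<in> objects S"
  by (auto simp: cartan_scheme_def)

lemma weyl_morphism_target:
  assumes "cartan_scheme S" "weyl_morphism S a b \<phi>"
  shows "b \<in> objects S"
  using assms(2) by (induction rule: weyl_morphism.induct) (auto simp: rho_in_objects[OF assms(1)])

lemma weyl_morphism_image: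
  assumes S: "cartan_scheme S" and R: "root_system S R" and "weyl_morphism S a b \<phi>"
  shows "\<phi> ` R a = R b"
  using assms(3)
proof (induction rule: weyl_morphism.induct)
  case identity
  then show ?case by simp
next
  case (compose_refl b \<phi> i)
  have "simple_reflection S i b ` R b = R (rho S i b)"
    using R weyl_morphism_target[OF S compose_refl.hyps] by (auto simp: root_system_def)
  then show ?case using compose_refl.IH by (metis image_comp)
qed

text \<open>In the basis of simple roots the reflection is triangular with diagonal entries -1 and
  1, so its determinant is -1.\<close>

lemma wedge_simple_reflection:
  assumes S: "cartan_scheme S" and U: "UNIV = {i, j}" and ij: "i \<noteq> j" and a: "a \<in> objects S"
  shows "wedge i j (simple_reflection S k a v) (simple_reflection S k a w) = - wedge i j v w"
proof -
  have c: "cartan S a $ k $ k = 2"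
    using S a by (auto simp: cartan_scheme_def generalized_cartan_matrix_def)
  have "k \<in> {i, j}" using U by auto
  then show ?thesis
    using c ij by (auto simp: wedge_def simple_reflection_eq U simple_root_nth algebra_simps)
qed

text \<open>Each reflection along the path contributes a factor -1.\<close>

lemma wedge_weyl_morphism:
  assumes S: "cartan_scheme S" and U: "UNIV = {i, j}" and ij: "i \<noteq> j"
    and "weyl_morphism S a b \<phi>"
  shows "\<exists>e\<in>{1, -1}. \<forall>v w. wedge i j (\<phi> v) (\<phi> w) = e * wedge i j v w"
  using assms(4)
proof (induction rule: weyl_morphism.induct)
  case identity
  then show ?case by auto
next
  case (compose_refl b \<phi> k)
  then show ?case
    using wedge_simple_reflection[OF S U ij weyl_morphism_target[OF S compose_refl.hyps]]
    by fastforce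
qed

lemma root_system_R1:
  assumes "root_system S R" "a \<in> objects S"
  shows "R a = positive_part (R a) \<union> uminus ` positive_part (R a)"
proof -
  have "\<forall>a\<in>objects S. R a = positive_part (R a) \<union> uminus ` positive_part (R a)"
    using assms(1) unfolding root_system_def by (rule conjunct1)
  then show ?thesis using assms(2) by (rule bspec)
qed

lemma root_same_sign:
  assumes "root_system S R" "a \<in> objects S" "v \<in> R a"
  shows "(\<forall>k. 0 \<le> v $ k) \<or> (\<forall>k. v $ k \<le> 0)"
proof -
  have "v \<in> positive_part (R a) \<union> uminus ` positive_part (R a)"
    using assms(3) root_system_R1[OF assms(1,2)] by (rule back_subst[where P = "\<lambda>X. v \<in> X"])
  then show ?thesis by (auto simp: positive_part_def)
qed

lemma uminus_root:
  assumes "root_system S R" "a \<in> objects S" "v \<in> R a"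
  shows "- v \<in> R a"
proof -
  let ?P = "positive_part (R a)"
  have "v \<in> ?P \<union> uminus ` ?P"
    using assms(3) root_system_R1[OF assms(1,2)] by (rule back_subst[where P = "\<lambda>X. v \<in> X"])
  then have "- v \<in> ?P \<union> uminus ` ?P" by (elim UnE) auto
  then show ?thesis
    using root_system_R1[OF assms(1,2), symmetric] by (rule back_subst[where P = "\<lambda>X. - v \<in> X"])
qed

lemma simple_root_in_root_system:
  assumes "root_system S R" "a \<in> objects S"
  shows "simple_root k \<in> R a"
proof -
  have "R a \<inter> {t *s simple_root k | t. True} = {simple_root k, - simple_root k}"
    using assms by (simp add: root_system_def)
  then show ?thesis by blast
qed

text \<open>As \<open>\<alpha>\<close>, \<open>\<beta>\<close> have determinant 1, the two factors
  in the last condition are the coordinates of \<open>v\<close> in this basis. The condition says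
  that no root lies strictly between \<open>\<alpha>\<close> and \<open>\<beta>\<close>. Such a
  \<open>\<beta>\<close> is the negative of a root that forms, with \<open>\<alpha>\<close>, the
  image of the simple roots up to a common sign.\<close>

lemma real_root_basis:
  fixes S :: "('i::finite, 'a) cartan_quadruple"
  assumes S: "cartan_scheme S" and R: "root_system S (real_roots S)"
    and U: "UNIV = {i, j :: 'i}" and ij: "i \<noteq> j"
    and a: "a \<in> objects S" and \<alpha>: "\<alpha> \<in> real_roots S a"
  obtains \<beta> where "\<beta> \<in> real_roots S a" "wedge i j \<alpha> \<beta> = 1"
    "\<And>v. v \<in> real_roots S a \<Longrightarrow> wedge i j v \<beta> * wedge i j \<alpha> v \<le> 0"
proof -
  obtain k \<phi> b where b: "b \<in> objects S" and \<phi>: "weyl_morphism S b a \<phi>" and \<alpha>_eq: "\<alpha> = \<phi> (simple_root k)"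
    using \<alpha> by (auto simp: real_roots_def weyl_hom_def)
  obtain l where l: "k \<noteq> l" "UNIV = {k, l}"
  proof (cases "k = i")
    case True
    then show thesis using that[of j] U ij by simp
  next
    case False
    then have "k = j" using U by auto
    then show thesis using that[of i] U ij by (simp add: insert_commute)
  qed
  \<comment> \<open>The sign of the ordering: 1 if \<open>k\<close>, \<open>l\<close> is
    \<open>i\<close>, \<open>j\<close>, and -1 if it is \<open>j\<close>, \<open>i\<close>.\<close>
  define f where "f = wedge i j (simple_root k) (simple_root l)"
  have f: "f = 1 \<or> f = -1"
    using l ij U unfolding f_def wedge_def simple_root_nth by (auto simp: doubleton_eq_iff)
  \<comment> \<open>A second morphism carrying \<open>simple_root k\<close> to a multiple of
    \<open>\<alpha>\<close>, namely \<open>- \<alpha>\<close>. Its determinant is opposite to that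
    of \<open>\<phi>\<close>, so one of the two yields the partner on the required side.\<close>
  define \<psi> where "\<psi> = \<phi> \<circ> simple_reflection S k (rho S k b)"
  have rb: "rho S k b \<in> objects S" using S b by (rule rho_in_objects)
  have "rho S k (rho S k b) = b" using S b by (auto simp: cartan_scheme_def)
  then have "weyl_morphism S (rho S k b) b (simple_reflection S k (rho S k b))"
    using weyl_morphism.compose_refl[OF weyl_morphism.identity[OF rb], of k] by simp
  then have \<psi>: "weyl_morphism S (rho S k b) a \<psi>"
    unfolding \<psi>_def by (rule weyl_morphism_compose[OF \<phi>])
  have "cartan S (rho S k b) $ k $ k = 2"
    using S rb by (auto simp: cartan_scheme_def generalized_cartan_matrix_def)
  then have neg: "simple_reflection S k (rho S k b) (simple_root k) = (- 1) *s simple_root k"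
    by (simp add: simple_reflection_simple_root vec_eq_iff)
  have \<psi>k: "\<psi> (simple_root k) = - \<alpha>"
    unfolding \<psi>_def comp_apply neg weyl_morphism_scale[OF \<phi>] \<alpha>_eq by (simp add: vec_eq_iff)
  \<comment> \<open>Roots at \<open>a\<close> are images of roots at \<open>c\<close>, whose
    coordinates have equal sign by (R1); linearity carries these coordinates over to the image
    basis.\<close>
  have basis: "\<theta> (simple_root l) \<in> real_roots S a \<and>
      (\<forall>v\<in>real_roots S a. \<exists>p q. 0 \<le> p * q \<and> v = p *s \<theta> (simple_root k) + q *s \<theta> (simple_root l))"
    if \<theta>: "weyl_morphism S c a \<theta>" and c: "c \<in> objects S" for c \<theta>
  proof (intro conjI ballI)
    have im: "\<theta> ` real_roots S c = real_roots S a" using weyl_morphism_image[OF S R \<theta>] .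
    show "\<theta> (simple_root l) \<in> real_roots S a"
      using im simple_root_in_root_system[OF R c] by blast
    fix v assume "v \<in> real_roots S a"
    then obtain w where w: "w \<in> real_roots S c" "v = \<theta> w" using im by blast
    have "w = w $ k *s simple_root k + w $ l *s simple_root l"
      using l by (simp add: vec_eq_two_iff[OF l(2)] simple_root_nth)
    then have "v = w $ k *s \<theta> (simple_root k) + w $ l *s \<theta> (simple_root l)"
      by (metis w(2) weyl_morphism_add[OF \<theta>] weyl_morphism_scale[OF \<theta>])
    moreover have "0 \<le> w $ k * w $ l"
      using root_same_sign[OF R c w(1)] by (auto simp: zero_le_mult_iff)
    ultimately show "\<exists>p q. 0 \<le> p * q \<and> v = p *s \<theta> (simple_root k) + q *s \<theta> (simple_root l)"
      by blast
  qed
  note obtained = that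
  \<comment> \<open>The witness is \<open>- \<gamma>\<close>: negation turns the determinant into 1
    and coordinates of equal sign into coordinates of opposite sign.\<close>
  have goal: thesis if \<gamma>: "\<gamma> \<in> real_roots S a" "wedge i j \<alpha> \<gamma> = -1"
    and cone: "\<And>v. v \<in> real_roots S a \<Longrightarrow> \<exists>p q. 0 \<le> p * q \<and> v = p *s \<alpha> + q *s \<gamma>" for \<gamma>
  proof (rule obtained)
    show "- \<gamma> \<in> real_roots S a" using uminus_root[OF R a \<gamma>(1)] .
    show "wedge i j \<alpha> (- \<gamma>) = 1" using \<gamma>(2) by (simp add: wedge_def)
    fix v assume "v \<in> real_roots S a"
    then obtain p q where pq: "0 \<le> p * q" "v = p *s \<alpha> + q *s \<gamma>" using cone by blast
    have "wedge i j v (- \<gamma>) = - p * wedge i j \<alpha> \<gamma>" "wedge i j \<alpha> v = q * wedge i j \<alpha> \<gamma>"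
      using pq(2) by (simp_all add: wedge_def algebra_simps)
    then show "wedge i j v (- \<gamma>) * wedge i j \<alpha> v \<le> 0" using \<gamma>(2) pq(1) by simp
  qed
  obtain e where e: "e = 1 \<or> e = -1" "\<And>v w. wedge i j (\<phi> v) (\<phi> w) = e * wedge i j v w"
    using wedge_weyl_morphism[OF S U ij \<phi>] by blast
  show thesis
  \<comment> \<open>\<open>e * f\<close> is the determinant of \<open>\<alpha>\<close> and
    \<open>\<phi> (simple_root l)\<close>.\<close>
  proof (cases "e * f = -1")
    case True
    then show thesis
      using basis[OF \<phi> b] goal[of "\<phi> (simple_root l)"] e(2) by (auto simp: \<alpha>_eq f_def)
  next
    case False
    \<comment> \<open>Negating both images under \<open>\<psi>\<close> restores
      \<open>\<alpha>\<close> as the first vector and leaves their determinant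
      \<open>- (e * f) = -1\<close> unchanged.\<close>
    let ?\<gamma> = "- \<psi> (simple_root l)"
    have "wedge i j (\<psi> (simple_root k)) (\<psi> (simple_root l)) = - (e * f)"
      using wedge_simple_reflection[OF S U ij rb] by (simp add: \<psi>_def e(2) f_def)
    then have "wedge i j \<alpha> ?\<gamma> = -1"
      using False e(1) f by (auto simp: \<psi>k wedge_def)
    moreover have "?\<gamma> \<in> real_roots S a"
      using basis[OF \<psi> rb] uminus_root[OF R a] by blast
    moreover have "\<exists>p q. 0 \<le> p * q \<and> v = p *s \<alpha> + q *s ?\<gamma>" if v: "v \<in> real_roots S a" for v
    proof -
      obtain p q where pq: "0 \<le> p * q" "v = p *s (- \<alpha>) + q *s \<psi> (simple_root l)"
        using basis[OF \<psi> rb] v \<psi>k by metis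
      then have "0 \<le> (- p) * (- q) \<and> v = (- p) *s \<alpha> + (- q) *s ?\<gamma>" by (simp add: vec_eq_iff)
      then show ?thesis by blast
    qed
    ultimately show thesis using goal by blast
  qed
qed

text \<open>The partner \<open>\<beta>\<close> from \<open>real_root_basis\<close> can only be
  negative if \<open>\<alpha>\<close> is the last positive root; otherwise
  \<open>simple_root j\<close> would lie strictly between \<open>\<alpha>\<close> and
  \<open>\<beta>\<close>.\<close>

lemma positive_root_successor:
  fixes S :: "('i::finite, 'a) cartan_quadruple"
  assumes S: "cartan_scheme S" and R: "root_system S (real_roots S)"
    and U: "UNIV = {i, j :: 'i}" and ij: "i \<noteq> j"
    and a: "a \<in> objects S" and \<alpha>: "\<alpha> \<in> positive_part (real_roots S a)"
    and ne: "\<alpha> \<noteq> simple_root j"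
  shows "\<exists>\<beta>\<in>positive_part (real_roots S a). wedge i j \<alpha> \<beta> = 1"
proof -
  have \<alpha>R: "\<alpha> \<in> real_roots S a" and nn: "0 \<le> \<alpha> $ i" "0 \<le> \<alpha> $ j"
    using \<alpha> by (auto simp: positive_part_def)
  obtain \<beta> where \<beta>: "\<beta> \<in> real_roots S a" "wedge i j \<alpha> \<beta> = 1"
    and cone: "\<And>v. v \<in> real_roots S a \<Longrightarrow> wedge i j v \<beta> * wedge i j \<alpha> v \<le> 0"
    using real_root_basis[OF S R U ij a \<alpha>R] by blast
  have "\<forall>k. 0 \<le> \<beta> $ k"
  proof (rule ccontr)
    assume "\<not> (\<forall>k. 0 \<le> \<beta> $ k)"
    then have neg: "\<beta> $ i \<le> 0" "\<beta> $ j \<le> 0" using root_same_sign[OF R a \<beta>(1)] by auto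
    \<comment> \<open>The betweenness condition tested on \<open>simple_root j\<close>. Together
      with the signs it makes one factor vanish; determinant 1 rules out
      \<open>\<beta> $ i = 0\<close>.\<close>
    have "- \<beta> $ i * \<alpha> $ i \<le> 0"
      using cone[OF simple_root_in_root_system[OF R a, of j]] ij
      by (simp add: wedge_def simple_root_nth)
    then have i0: "\<beta> $ i = 0 \<or> \<alpha> $ i = 0"
      using nn neg by (auto simp: mult_le_0_iff zero_le_mult_iff)
    have det: "\<alpha> $ i * \<beta> $ j - \<alpha> $ j * \<beta> $ i = 1" using \<beta>(2) by (simp add: wedge_def)
    have "\<alpha> $ i * \<beta> $ j \<le> 0" using nn neg by (simp add: mult_nonneg_nonpos)
    then have "\<alpha> $ i = 0" using i0 det by auto
    then have "\<alpha> $ j * - \<beta> $ i = 1" using det by simp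
    then have "\<alpha> $ j = 1" using nn zmult_eq_1_iff[of "\<alpha> $ j" "- \<beta> $ i"] by auto
    then show False
      using ne \<open>\<alpha> $ i = 0\<close> ij by (simp add: vec_eq_two_iff[OF U] simple_root_nth)
  qed
  then show ?thesis using \<beta> by (auto simp: positive_part_def)
qed

theorem corollary3p8:
  fixes S :: "('i::finite, 'a) cartan_quadruple"
  assumes "cartan_scheme_rank_two S"
    and "finite_root_system S (real_roots S)"
  shows "\<forall>a\<in>objects S. \<forall>\<alpha>\<in>positive_part (real_roots S a).
           (\<exists>i. \<alpha> = simple_root i) \<or>
           (\<exists>\<beta>\<in>positive_part (real_roots S a).
              \<exists>\<gamma>\<in>positive_part (real_roots S a). \<alpha> = \<beta> + \<gamma>)"
proof (intro ballI)
  fix a \<alpha> assume a: "a \<in> objects S" and \<alpha>: "\<alpha> \<in> positive_part (real_roots S a)"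
  have S: "cartan_scheme S" and R: "root_system S (real_roots S)"
    and fin: "finite (real_roots S a)" and card: "CARD('i) = 2"
    using assms a by (auto simp: cartan_scheme_rank_two_def finite_root_system_def)
  obtain i j :: 'i where U: "UNIV = {i, j}" and ij: "i \<noteq> j"
    using card by (auto simp: card_2_iff)
  have U': "UNIV = {j, i}" using U by auto
  \<comment> \<open>Exchanging the indices reverses the slope order, so predecessors are successors
    for the pair \<open>j\<close>, \<open>i\<close>.\<close>
  have swap: "wedge j i x y = wedge i j y x" for x y
    by (simp add: wedge_def)
  have "\<alpha> = simple_root i \<or> \<alpha> = simple_root j \<or>
    (\<exists>\<beta>\<in>positive_part (real_roots S a). \<exists>\<gamma>\<in>positive_part (real_roots S a). \<alpha> = \<beta> + \<gamma>)"
  proof (rule unimodular_set_decomposition[OF U ij _ _ _ _ \<alpha>])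
    show "finite (positive_part (real_roots S a))" using fin by (simp add: positive_part_def)
    show "0 \<le> x $ i \<and> 0 \<le> x $ j" if "x \<in> positive_part (real_roots S a)" for x
      using that by (simp add: positive_part_def)
    show "\<exists>y\<in>positive_part (real_roots S a). wedge i j x y = 1"
      if "x \<in> positive_part (real_roots S a)" "x \<noteq> simple_root j" for x
      using positive_root_successor[OF S R U ij a that] .
    show "\<exists>y\<in>positive_part (real_roots S a). wedge i j y x = 1"
      if "x \<in> positive_part (real_roots S a)" "x \<noteq> simple_root i" for x
      using positive_root_successor[OF S R U' ij[symmetric] a that] unfolding swap .
  qed
  then show "(\<exists>i. \<alpha> = simple_root i) \<or>
    (\<exists>\<beta>\<in>positive_part (real_roots S a). \<exists>\<gamma>\<in>positive_part (real_roots S a). \<alpha> = \<beta> + \<gamma>)"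
    by blast
qed

end
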